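(* $\mathcal{B}_k$ is an empty set for any integer $k\geq 4$.
   Context: All groups are finite. For a group $G$ and a subset $S\subseteq G$ with $1_G\notin S=S^{-1}$, $\mathrm{Cay}(G,S)$ is the undirected graph with vertex set $G$ in which $g,h$ are adjacent if and only if $hg^{-1}\in S$. A graph $\Gamma$ is $2$-integral if $[\mathbb{SF}(\Gamma):\mathbb{Q}]=2$, where $\mathbb{SF}(\Gamma)$ is the smallest field extension of $\mathbb{Q}$ containing all eigenvalues of the adjacency matrix of $\Gamma$. For an integer $k\geq 2$, $\mathcal{B}_k$ is the set of all groups $G$ such that $\mathrm{Cay}(G,S)$ is $2$-integral whenever $S\subset G$ satisfies $1_G\notin S=S^{-1}$ and $2\leq|S|\leq k$.
   Formalization: Groups of order 1 and 2 have no admissible S with |S| ≥ 2, so they belong to B_k vacuously and the literal claim fails; the formal theorem says that for k ≥ 4 the set B_k contains no group of order at least 3. *)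

theory Defs
  imports
    "HOL-Algebra.Generated_Fields"
    "HOL-Algebra.Embedded_Algebras"
    "HOL-Algebra.Algebraic_Closure_Type"
    "Jordan_Normal_Form.Spectral_Radius"
    "Graph_Theory.Pair_Digraph"
begin

definition connection_set :: "('a, 'b) monoid_scheme \<Rightarrow> 'a set \<Rightarrow> bool" where
  "connection_set G S \<longleftrightarrow>
     S \<subseteq> carrier G \<and> \<one>\<^bsub>G\<^esub> \<notin> S \<and> S = (\<lambda>s. inv\<^bsub>G\<^esub> s) ` S"

(* An undirected graph is a pair digraph with symmetric, irreflexive arc set
   (locale pair_graph); see pair_graph_Cay. *)
definition Cay :: "('a, 'b) monoid_scheme \<Rightarrow> 'a set \<Rightarrow> 'a pair_pre_digraph" where
  "Cay G S = \<lparr> pverts = carrier G,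
     parcs = {(g, h). g \<in> carrier G \<and> h \<in> carrier G \<and> h \<otimes>\<^bsub>G\<^esub> inv\<^bsub>G\<^esub> g \<in> S} \<rparr>"

lemma pair_graph_Cay:
  assumes "group G" and fin: "finite (carrier G)" and S: "connection_set G S"
  shows "pair_graph (Cay G S)"
proof -
  interpret group G by fact
  have sym: "g \<otimes>\<^bsub>G\<^esub> inv\<^bsub>G\<^esub> h \<in> S"
    if "g \<in> carrier G" "h \<in> carrier G" "h \<otimes>\<^bsub>G\<^esub> inv\<^bsub>G\<^esub> g \<in> S" for g h
  proof -
    have "inv\<^bsub>G\<^esub> (h \<otimes>\<^bsub>G\<^esub> inv\<^bsub>G\<^esub> g) \<in> S"
      using S that(3) unfolding connection_set_def by blast
    then show ?thesis using that by (simp add: inv_mult_group)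
  qed
  have "finite (parcs (Cay G S))"
    by (rule finite_subset[of _ "carrier G \<times> carrier G"]) (auto simp: Cay_def fin)
  then show ?thesis
    using fin S sym
    by unfold_locales
      (auto simp: Cay_def connection_set_def symmetric_def symmetric_conv sym_def)
qed

definition adjacency_matrix :: "'a pair_pre_digraph \<Rightarrow> 'a list \<Rightarrow> complex mat" where
  "adjacency_matrix \<Gamma> vs =
     mat (length vs) (length vs) (\<lambda>(i, j). if (vs ! i, vs ! j) \<in> parcs \<Gamma> then 1 else 0)"

(* Matrices are indexed by natural numbers, so the vertices are enumerated; two
   enumerations give matrices that differ by a simultaneous permutation of rows and
   columns, so the eigenvalues do not depend on the enumeration. *)
definition graph_eigenvalues :: "'a pair_pre_digraph \<Rightarrow> complex set" where
  "graph_eigenvalues \<Gamma> =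
     {x. \<exists>vs. distinct vs \<and> set vs = pverts \<Gamma> \<and> eigenvalue (adjacency_matrix \<Gamma> vs) x}"

abbreviation complex_ring :: "complex ring" where
  "complex_ring \<equiv> ring_of_type_algebra"

(* \<rat> is the subfield of rational numbers of the complex numbers. *)
definition splitting_field :: "'a pair_pre_digraph \<Rightarrow> complex set" where
  "splitting_field \<Gamma> = generate_field complex_ring (\<rat> \<union> graph_eigenvalues \<Gamma>)"

definition two_integral :: "'a pair_pre_digraph \<Rightarrow> bool" where
  "two_integral \<Gamma> \<longleftrightarrow> ring.dimension complex_ring 2 \<rat> (splitting_field \<Gamma>)"

definition \<B> :: "nat \<Rightarrow> 'a monoid set" where
  "\<B> k = {G. group G \<and> finite (carrier G) \<and>
     (\<forall>S. connection_set G S \<and> 2 \<le> card S \<and> card S \<le> k \<longrightarrow> two_integral (Cay G S))}"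

(* A group of order at most 2 has no connection set with two or more elements, so it
   satisfies the condition defining \<B> k vacuously. *)
lemma order_le_2_in_\<B>:
  fixes G :: "'a monoid"
  assumes "group G" and fin: "finite (carrier G)" and le: "Coset.order G \<le> 2"
  shows "G \<in> \<B> k"
proof -
  interpret group G by fact
  have "card S \<le> 1" if "connection_set G S" for S
  proof -
    have "S \<subseteq> carrier G - {\<one>\<^bsub>G\<^esub>}"
      using that by (auto simp: connection_set_def)
    then have "card S \<le> card (carrier G - {\<one>\<^bsub>G\<^esub>})"
      by (intro card_mono) (auto simp: fin)
    also have "\<dots> \<le> 1"
      using le fin by (simp add: Coset.order_def)
    finally show ?thesis .
  qed
  then show ?thesis
    using assms(1) fin by (fastforce simp: \<B>_def)
qed

end

theory Submission
  imports Defs "HOL-Algebra.Sylow"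
begin

text \<open>
  A finite group \<open>G\<close> of order at least 3 has order divisible by 3, 4, 5 or by a prime \<open>p \<ge> 7\<close>.
  In the first case Sylow's theorem yields a subgroup \<open>H\<close> of order 3, 4 or 5; for
  \<open>S = H - {1}\<close> every component of the Cayley graph is complete, so all eigenvalues are rational
  and the splitting field has degree 1. In the second case take \<open>h\<close> of order \<open>p\<close> and
  \<open>S = {h, h\<^sup>-\<^sup>1}\<close>. Then \<open>\<zeta> + \<zeta>\<^sup>-\<^sup>1\<close> is an eigenvalue for \<open>\<zeta> = exp (2\<pi>i/p)\<close>, and if it satisfied a
  quadratic equation over the rationals, then \<open>\<zeta>\<close> would be a root of a nonzero rational polynomial
  of degree at most 4, less than \<open>p - 1\<close>, the degree of the irreducible polynomial
  \<open>1 + x + \<dots> + x\<^sup>p\<^sup>-\<^sup>1\<close>.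
\<close>

section \<open>Irreducibility of the prime cyclotomic polynomial\<close>

text \<open>Let \<open>i\<close> be the first index with \<open>p\<close> not dividing
  \<open>coeff f i\<close>. Modulo \<open>p\<close>, coefficient \<open>i\<close> of the product is
  \<open>coeff f i * coeff g 0\<close>, which is nonzero, so
  \<open>degree (f * g) \<le> i \<le> degree f\<close>.\<close>

lemma eisenstein_aux:
  fixes f g :: "int poly"
  assumes p: "prime p" and g0: "\<not> p dvd coeff g 0" and lead: "\<not> p dvd lead_coeff f"
    and low: "\<And>i. i < degree (f * g) \<Longrightarrow> p dvd coeff (f * g) i"
  shows "degree g = 0"
proof -
  define i where "i = (LEAST i. \<not> p dvd coeff f i)"
  have i: "\<not> p dvd coeff f i"
    unfolding i_def using lead by (rule LeastI)
  have less: "p dvd coeff f j" if "j < i" for j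
    using not_less_Least that unfolding i_def by blast
  have "i \<le> degree f"
    unfolding i_def using lead by (rule Least_le)
  have "f \<noteq> 0" "g \<noteq> 0"
    using g0 lead by auto
  have "coeff (f * g) i = (\<Sum>j\<le>i. coeff f j * coeff g (i - j))"
    by (simp add: coeff_mult)
  also have "\<dots> = coeff f i * coeff g 0 + (\<Sum>j<i. coeff f j * coeff g (i - j))"
    by (simp add: lessThan_Suc_atMost[symmetric])
  finally have eq: "coeff (f * g) i = coeff f i * coeff g 0 + (\<Sum>j<i. coeff f j * coeff g (i - j))" .
  have "p dvd (\<Sum>j<i. coeff f j * coeff g (i - j))"
    using less by (intro dvd_sum) auto
  moreover have "\<not> p dvd coeff f i * coeff g 0"
    using p i g0 by (simp add: prime_dvd_mult_iff)
  ultimately have "\<not> p dvd coeff (f * g) i"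
    unfolding eq by (simp add: dvd_add_left_iff)
  then have "degree (f * g) \<le> i"
    using low not_less by blast
  then show ?thesis
    using \<open>i \<le> degree f\<close> \<open>f \<noteq> 0\<close> \<open>g \<noteq> 0\<close> by (simp add: degree_mult_eq)
qed

text \<open>If \<open>p\<close> divided both constant coefficients, its square would divide their
  product. The factor whose constant coefficient escapes \<open>p\<close> takes the place of
  \<open>g\<close> in \<open>eisenstein_aux\<close>.\<close>

lemma eisenstein:
  fixes f g :: "int poly"
  assumes p: "prime p" and lead: "\<not> p dvd lead_coeff (f * g)"
    and low: "\<And>i. i < degree (f * g) \<Longrightarrow> p dvd coeff (f * g) i"
    and sq: "\<not> p\<^sup>2 dvd coeff (f * g) 0"
  shows "degree f = 0 \<or> degree g = 0"
proof -
  have "\<not> p dvd lead_coeff f" "\<not> p dvd lead_coeff g"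
    using lead by (auto simp: lead_coeff_mult)
  moreover have "\<not> p dvd coeff f 0 \<or> \<not> p dvd coeff g 0"
    using sq mult_dvd_mono[of p "coeff f 0" p "coeff g 0"] by (auto simp: power2_eq_square coeff_mult)
  ultimately show ?thesis
    using eisenstein_aux[OF p, of g f] eisenstein_aux[OF p, of f g] low by (auto simp: mult.commute)
qed

definition prime_cyclotomic :: "nat \<Rightarrow> int poly" where
  "prime_cyclotomic p = (\<Sum>i<p. monom 1 i)"

text \<open>Multiplying the polynomial by \<open>x - 1\<close> gives \<open>x ^ p - 1\<close>. After
  \<open>x\<close> is replaced by \<open>x + 1\<close> this says that \<open>x\<close> times the
  shifted polynomial is \<open>(x + 1) ^ p - 1\<close>; cancelling \<open>x\<close> moves every
  index by one, hence \<open>Suc i\<close>.\<close>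

lemma coeff_prime_cyclotomic_shift:
  "coeff (prime_cyclotomic p \<circ>\<^sub>p [:1, 1:]) i = int (p choose Suc i)"
proof -
  have "prime_cyclotomic p = (\<Sum>i<p. [:0, 1:] ^ i)"
    by (simp add: prime_cyclotomic_def monom_altdef)
  then have "prime_cyclotomic p * ([:0, 1:] - 1) = [:0, 1:] ^ p - 1"
    by (simp only: power_diff_1_eq mult.commute)
  then have "(prime_cyclotomic p * ([:0, 1:] - 1)) \<circ>\<^sub>p [:1, 1:] = ([:0, 1:] ^ p - 1) \<circ>\<^sub>p [:1, 1:]"
    by simp
  then have *: "pCons 0 (prime_cyclotomic p \<circ>\<^sub>p [:1, 1:]) = [:1, 1:] ^ p - 1"
    by (simp add: pcompose_mult pcompose_diff pcompose_pCons pcompose_hom.hom_power mult.commute one_pCons)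
  have "coeff (prime_cyclotomic p \<circ>\<^sub>p [:1, 1:]) i = coeff (([:1, 1:] :: int poly) ^ p - 1) (Suc i)"
    unfolding *[symmetric] by simp
  also have "\<dots> = coeff (([:1, 1:] :: int poly) ^ p) (Suc i)"
    by simp
  also have "\<dots> = int (p choose Suc i)"
  proof (cases "Suc i \<le> p")
    case True
    then show ?thesis
      by (simp add: coeff_linear_poly_power)
  next
    case False
    then show ?thesis
      by (simp add: coeff_eq_0 degree_power_eq binomial_eq_0)
  qed
  finally show ?thesis .
qed

lemma degree_prime_cyclotomic:
  assumes "p > 0"
  shows "degree (prime_cyclotomic p) = p - 1"
proof (rule antisym)
  show "degree (prime_cyclotomic p) \<le> p - 1"
    unfolding prime_cyclotomic_def
    by (intro degree_sum_le) (auto simp: degree_monom_eq)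
  have "coeff (prime_cyclotomic p) (p - 1) = 1"
    using assms by (simp add: prime_cyclotomic_def coeff_sum sum.delta)
  then show "p - 1 \<le> degree (prime_cyclotomic p)"
    by (intro le_degree) simp
qed

text \<open>The shift preserves degrees and products, and Eisenstein's criterion applies after it:
  the leading coefficient is 1, the lower ones are binomials divisible by \<open>p\<close>, and the
  constant one is \<open>p\<close> itself.\<close>

lemma prime_cyclotomic_factor:
  assumes p: "prime p" and fg: "prime_cyclotomic p = f * g"
  shows "degree f = 0 \<or> degree g = 0"
proof -
  let ?f = "f \<circ>\<^sub>p [:1, 1:]" and ?g = "g \<circ>\<^sub>p [:1, 1:]"
  have "p > 1"
    using p by (rule prime_gt_1_nat)
  have eq: "?f * ?g = prime_cyclotomic p \<circ>\<^sub>p [:1, 1:]"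
    by (simp add: fg pcompose_mult)
  have deg: "degree (?f * ?g) = p - 1"
    using \<open>p > 1\<close> by (simp add: eq degree_pcompose degree_prime_cyclotomic)
  have "degree ?f = 0 \<or> degree ?g = 0"
  proof (rule eisenstein[of "int p"])
    show "prime (int p)"
      using p by simp
    show "\<not> int p dvd lead_coeff (?f * ?g)"
      using \<open>p > 1\<close> by (simp add: deg) (simp add: eq coeff_prime_cyclotomic_shift)
    show "int p dvd coeff (?f * ?g) i" if "i < degree (?f * ?g)" for i
      using that p by (simp only: deg) (auto simp: eq coeff_prime_cyclotomic_shift intro!: dvd_choose_prime)
    show "\<not> (int p)\<^sup>2 dvd coeff (?f * ?g) 0"
    proof
      assume "(int p)\<^sup>2 dvd coeff (?f * ?g) 0"
      then have "p * p dvd p * 1"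
        by (simp only: eq coeff_prime_cyclotomic_shift) (simp add: power2_eq_square flip: of_nat_mult)
      then show False
        using \<open>p > 1\<close> by simp
    qed
  qed
  then show ?thesis
    by (simp add: degree_pcompose)
qed

section \<open>Integer polynomials vanishing at a root of unity\<close>

text \<open>Such an \<open>F\<close> is a scalar multiple of the minimal polynomial of
  \<open>x\<close>. Pseudo-division keeps the argument over the integers.\<close>

lemma degree_minimal_int_poly:
  fixes x :: complex and f F :: "int poly"
  assumes irr: "\<And>g h. F = g * h \<Longrightarrow> degree g = 0 \<or> degree h = 0"
    and prim: "content F = 1"
    and F: "poly (map_poly of_int F) x = 0"
    and f: "f \<noteq> 0" "poly (map_poly of_int f) x = 0"
  shows "degree F \<le> degree f"
proof -
  define P where "P d \<longleftrightarrow> (\<exists>f :: int poly. f \<noteq> 0 \<and> poly (map_poly of_int f) x = 0 \<and> degree f = d)" for d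
  define d where "d = (LEAST d. P d)"
  have Pf: "P (degree f)"
    using f by (auto simp: P_def)
  then have "P d"
    unfolding d_def by (rule LeastI)
  \<comment> \<open>By minimality \<open>h\<close> divides a nonzero multiple of \<open>F\<close>; Gauss's lemma turns this into a
    factorization of \<open>F\<close> itself.\<close>
  then obtain h :: "int poly" where h: "h \<noteq> 0" "poly (map_poly of_int h) x = 0" "degree h = d"
    unfolding P_def by blast
  have "degree h \<noteq> 0"
  proof
    assume "degree h = 0"
    then obtain c where "h = [:c:]"
      by (rule degree_eq_zeroE)
    then show False
      using h by simp
  qed
  obtain a q where a: "a \<noteq> 0" and aq: "smult a F = h * q + pseudo_mod F h"
    using pseudo_mod(1)[OF h(1)] by blast
  have "poly (map_poly of_int (smult a F)) x = 0"
    using F by (simp add: of_int_hom.map_poly_hom_smult)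
  then have r: "poly (map_poly of_int (pseudo_mod F h)) x = 0"
    unfolding aq using h by (simp add: of_int_poly_hom.hom_add of_int_poly_hom.hom_mult)
  have "pseudo_mod F h = 0"
  proof (rule ccontr)
    assume nz: "pseudo_mod F h \<noteq> 0"
    then have "P (degree (pseudo_mod F h))"
      using r by (auto simp: P_def)
    then have "d \<le> degree (pseudo_mod F h)"
      unfolding d_def by (rule Least_le)
    then show False
      using pseudo_mod(2)[OF h(1), of F] nz h(3) by simp
  qed
  then have aq: "smult a F = h * q"
    using aq by simp
  have cont: "content h * content q = \<bar>a\<bar>"
    using arg_cong[OF aq, of content] prim by (simp add: content_mult)
  have "h * q = smult (content h * content q) (primitive_part h * primitive_part q)"
    by (metis content_times_primitive_part mult_smult_left mult_smult_right smult_smult)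
  \<comment> \<open>\<open>a * sgn a\<close> is the absolute value of \<open>a\<close>; in this form
    \<open>a\<close> cancels and only its sign remains.\<close>
  then have "smult a F = smult (a * sgn a) (primitive_part h * primitive_part q)"
    using cont aq by (simp add: abs_sgn)
  then have "smult a F = smult a (smult (sgn a) (primitive_part h) * primitive_part q)"
    by simp
  then have Fh: "F = smult (sgn a) (primitive_part h) * primitive_part q"
    using a by (metis smult_cancel)
  then have "degree (smult (sgn a) (primitive_part h)) = 0 \<or> degree (primitive_part q) = 0"
    by (rule irr)
  then have "degree q = 0"
    using \<open>degree h \<noteq> 0\<close> a by (auto simp: sgn_if split: if_splits)
  then have "degree F = degree h"
    using arg_cong[OF aq, of degree] arg_cong[OF aq, of content] prim a h
    by (cases "q = 0") (auto simp: degree_mult_eq)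
  also have "\<dots> \<le> degree f"
    unfolding h d_def using Pf by (rule Least_le)
  finally show ?thesis .
qed

text \<open>The geometric sum makes \<zeta> a root of \<open>prime_cyclotomic p\<close>, which is
  primitive because it has a coefficient 1.\<close>

lemma degree_int_poly_root_of_unity:
  fixes \<zeta> :: complex and f :: "int poly"
  assumes p: "prime p" and \<zeta>: "\<zeta> ^ p = 1" "\<zeta> \<noteq> 1"
    and f: "f \<noteq> 0" "poly (map_poly of_int f) \<zeta> = 0"
  shows "p - 1 \<le> degree f"
proof -
  have "p > 0"
    using p by (rule prime_gt_0_nat)
  have "degree (prime_cyclotomic p) \<le> degree f"
  proof (rule degree_minimal_int_poly[OF _ _ _ f])
    show "degree g = 0 \<or> degree h = 0" if "prime_cyclotomic p = g * h" for g h
      using p that by (rule prime_cyclotomic_factor)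
    have "coeff (prime_cyclotomic p) (p - 1) = 1"
      using \<open>p > 0\<close> by (simp add: prime_cyclotomic_def coeff_sum sum.delta)
    then have "content (prime_cyclotomic p) dvd 1"
      by (metis content_dvd_coeff)
    then show "content (prime_cyclotomic p) = 1"
      by (metis is_unit_normalize normalize_content)
    have "poly (map_poly of_int (prime_cyclotomic p)) \<zeta> = (\<Sum>i<p. \<zeta> ^ i)"
      by (simp add: prime_cyclotomic_def of_int_poly_hom.hom_sum poly_sum poly_monom)
    also have "\<dots> = 0"
      using geometric_sum[of \<zeta> p] \<zeta> by simp
    finally show "poly (map_poly of_int (prime_cyclotomic p)) \<zeta> = 0" .
  qed
  then show ?thesis
    using \<open>p > 0\<close> by (simp add: degree_prime_cyclotomic)
qed

text \<open>Clears the denominators of a rational quadratic, so that the degree bound for integer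
  polynomials applies.\<close>

lemma Rats_common_denominator:
  fixes a b c :: "'a :: field_char_0"
  assumes "a \<in> \<rat>" "b \<in> \<rat>" "c \<in> \<rat>"
  obtains m i j k :: int where "m \<noteq> 0"
    "of_int m * a = of_int i" "of_int m * b = of_int j" "of_int m * c = of_int k"
proof -
  obtain a1 a2 where a: "a2 > 0" "a = of_int a1 / of_int a2"
    using assms(1) by (rule Rats_cases')
  obtain b1 b2 where b: "b2 > 0" "b = of_int b1 / of_int b2"
    using assms(2) by (rule Rats_cases')
  obtain c1 c2 where c: "c2 > 0" "c = of_int c1 / of_int c2"
    using assms(3) by (rule Rats_cases')
  show ?thesis
    by (rule that[of "a2 * b2 * c2" "a1 * b2 * c2" "b1 * a2 * c2" "c1 * a2 * b2"])
      (use a b c in auto)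
qed

lemma no_rational_quadratic:
  fixes \<zeta> a b c :: complex
  assumes p: "prime p" "p \<ge> 7" and \<zeta>: "\<zeta> ^ p = 1" "\<zeta> \<noteq> 1"
    and rat: "a \<in> \<rat>" "b \<in> \<rat>" "c \<in> \<rat>"
    and eq: "a + b * (\<zeta> + inverse \<zeta>) + c * (\<zeta> + inverse \<zeta>)\<^sup>2 = 0"
  shows "a = 0 \<and> b = 0 \<and> c = 0"
proof (rule ccontr)
  assume nz: "\<not> (a = 0 \<and> b = 0 \<and> c = 0)"
  obtain m i j k :: int where m: "m \<noteq> 0"
    and ijk: "of_int m * a = of_int i" "of_int m * b = of_int j" "of_int m * c = of_int k"
    using Rats_common_denominator[OF rat] by metis
  have "\<zeta> \<noteq> 0"
    using p(2) \<zeta> by (auto simp: power_0_left)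
  \<comment> \<open>This is \<open>m * x ^ 2\<close> times the quadratic in
    \<open>x + 1 / x\<close>, hence palindromic; \<open>2 * k\<close> is the middle term of the
    square. Its degree is at most 4, while \<open>p - 1\<close> is at least 6.\<close>
  define f where "f = [:k, j, i + 2 * k, j, k:]"
  have "\<not> (i = 0 \<and> j = 0 \<and> k = 0)"
    using m nz ijk by auto
  then have "f \<noteq> 0"
    by (auto simp: f_def)
  moreover have "poly (map_poly of_int f) \<zeta> = 0"
  proof -
    \<comment> \<open>With \<open>w\<close> for the inverse of \<zeta>, the expansion is a
      polynomial identity modulo \<open>\<zeta> * w = 1\<close>, free of division.\<close>
    have "c + b * \<zeta> + (a + 2 * c) * \<zeta> ^ 2 + b * \<zeta> ^ 3 + c * \<zeta> ^ 4 =
        \<zeta> ^ 2 * (a + b * (\<zeta> + w) + c * (\<zeta> + w)\<^sup>2)" if "\<zeta> * w = 1" for w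
    proof -
      have "\<zeta> ^ 2 * (a + b * (\<zeta> + w) + c * (\<zeta> + w)\<^sup>2) =
          a * \<zeta> ^ 2 + b * \<zeta> * (\<zeta> ^ 2 + \<zeta> * w) + c * (\<zeta> ^ 2 + \<zeta> * w)\<^sup>2"
        by (simp add: algebra_simps power2_eq_square)
      also have "\<dots> = c + b * \<zeta> + (a + 2 * c) * \<zeta> ^ 2 + b * \<zeta> ^ 3 + c * \<zeta> ^ 4"
        unfolding that by (simp add: algebra_simps power2_eq_square power3_eq_cube power4_eq_xxxx)
      finally show ?thesis ..
    qed
    from this[of "inverse \<zeta>"]
    have "of_int m * (c + b * \<zeta> + (a + 2 * c) * \<zeta> ^ 2 + b * \<zeta> ^ 3 + c * \<zeta> ^ 4) = 0"
      using \<open>\<zeta> \<noteq> 0\<close> by (simp add: eq)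
    moreover have "poly (map_poly of_int f) \<zeta> =
        of_int m * (c + b * \<zeta> + (a + 2 * c) * \<zeta> ^ 2 + b * \<zeta> ^ 3 + c * \<zeta> ^ 4)"
      by (simp add: f_def of_int_hom.map_poly_pCons_hom ijk[symmetric] algebra_simps
          power2_eq_square power3_eq_cube power4_eq_xxxx)
    ultimately show ?thesis
      by simp
  qed
  ultimately have "p - 1 \<le> degree f"
    using degree_int_poly_root_of_unity[OF p(1) \<zeta>] by blast
  also have "degree f \<le> 4"
    by (simp add: f_def)
  finally show False
    using p(2) by simp
qed

section \<open>The rational subfield and the degree of the splitting field\<close>

lemma complex_ring_simps [simp]:
  "carrier complex_ring = UNIV" "\<one>\<^bsub>complex_ring\<^esub> = 1" "\<zero>\<^bsub>complex_ring\<^esub> = 0"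
  "x \<otimes>\<^bsub>complex_ring\<^esub> y = x * y" "x \<oplus>\<^bsub>complex_ring\<^esub> y = x + y"
  by (simp_all add: ring_of_type_algebra_def)

lemma complex_ring_a_inv [simp]: "\<ominus>\<^bsub>complex_ring\<^esub> x = - x"
proof -
  interpret complex_ring: field complex_ring
    by (rule field_from_type_algebra)
  show ?thesis
    by (rule complex_ring.minus_equality) auto
qed

lemma complex_ring_m_inv [simp]: "x \<noteq> 0 \<Longrightarrow> inv\<^bsub>complex_ring\<^esub> x = inverse x"
proof -
  interpret complex_ring: field complex_ring
    by (rule field_from_type_algebra)
  show "x \<noteq> 0 \<Longrightarrow> inv\<^bsub>complex_ring\<^esub> x = inverse x"
    by (rule complex_ring.comm_inv_char) auto
qed

lemma subfield_Rats: "subfield \<rat> complex_ring"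
proof -
  interpret complex_ring: field complex_ring
    by (rule field_from_type_algebra)
  show ?thesis
  proof (rule complex_ring.subfieldI')
    show "subring \<rat> complex_ring"
      by (rule complex_ring.subringI) auto
  qed auto
qed

text \<open>Rational eigenvalues add nothing to \<rat>, so the splitting field has dimension 1, and
  dimension is unique.\<close>

lemma rational_eigenvalues_not_two_integral:
  assumes "graph_eigenvalues \<Gamma> \<subseteq> \<rat>"
  shows "\<not> two_integral \<Gamma>"
proof
  interpret complex_ring: field complex_ring
    by (rule field_from_type_algebra)
  assume "two_integral \<Gamma>"
  moreover have "splitting_field \<Gamma> = \<rat>"
    unfolding splitting_field_def
    by (rule complex_ring.generate_fieldI[symmetric]) (use assms subfield_Rats in auto)
  ultimately have "complex_ring.dimension 2 \<rat> \<rat>"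
    by (simp add: two_integral_def)
  then have "(2::nat) = 1"
    using complex_ring.dimension_is_inj[OF subfield_Rats] complex_ring.dimension_one[OF subfield_Rats]
    by blast
  then show False
    by simp
qed

text \<open>The three elements \<open>1\<close>, \<open>x\<close>, \<open>x\<^sup>2\<close> of a
  two-dimensional space are linearly dependent.\<close>

lemma eigenvalue_quadratic:
  assumes two: "two_integral \<Gamma>" and x: "x \<in> graph_eigenvalues \<Gamma>"
  obtains a b c where "a \<in> \<rat>" "b \<in> \<rat>" "c \<in> \<rat>" "\<not> (a = 0 \<and> b = 0 \<and> c = 0)"
    "a + b * x + c * x\<^sup>2 = 0"
proof -
  interpret complex_ring: field complex_ring
    by (rule field_from_type_algebra)
  let ?K = "splitting_field \<Gamma>"
  have K: "subfield ?K complex_ring"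
    unfolding splitting_field_def by (rule complex_ring.generate_field_is_subfield) simp
  have "x \<in> ?K"
    unfolding splitting_field_def using x by (auto intro: generate_field.incl)
  moreover have "x * x \<in> ?K" "1 \<in> ?K"
    using subringE(3)[OF subfieldE(1)[OF K]] subringE(6)[OF subfieldE(1)[OF K], of x x] calculation
    by simp_all
  ultimately have "set [1, x, x\<^sup>2] \<subseteq> ?K"
    by (simp add: power2_eq_square)
  then have "\<not> complex_ring.independent \<rat> [1, x, x\<^sup>2]"
    using complex_ring.independent_length_le_dimension[OF subfield_Rats] two
    unfolding two_integral_def by fastforce
  then obtain Ks where Ks: "length Ks = length [1, x, x\<^sup>2]" 
      "complex_ring.combine Ks [1, x, x\<^sup>2] = 0" "set Ks \<subseteq> \<rat>" "set Ks \<noteq> {0}"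
    using complex_ring.dependent_imp_non_trivial_combine[OF subfield_Rats, of "[1, x, x\<^sup>2]"]
    by auto
  then obtain a b c where "Ks = [a, b, c]"
    by (auto simp: length_Suc_conv)
  then show ?thesis
    using that[of a b c] Ks by (auto simp: add.assoc)
qed

section \<open>Eigenvalues through functions on the vertices\<close>

lemma eigenvector_adjacency_matrix:
  assumes vs: "distinct vs" "set vs = pverts \<Gamma>"
  shows "eigenvector (adjacency_matrix \<Gamma> vs) (vec (length vs) (\<lambda>i. f (vs ! i))) x \<longleftrightarrow>
    (\<exists>u\<in>pverts \<Gamma>. f u \<noteq> 0) \<and>
    (\<forall>u\<in>pverts \<Gamma>. (\<Sum>w | w \<in> pverts \<Gamma> \<and> (u, w) \<in> parcs \<Gamma>. f w) = x * f u)"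
proof -
  let ?n = "length vs" and ?v = "vec (length vs) (\<lambda>i. f (vs ! i))"
  let ?A = "adjacency_matrix \<Gamma> vs"
  have bij: "bij_betw ((!) vs) {0..<?n} (pverts \<Gamma>)"
    using bij_betw_nth[OF vs(1)] vs(2) by (simp add: atLeast0LessThan)
  have fin: "finite (pverts \<Gamma>)"
    using vs(2) by (metis List.finite_set)
  have "(?A *\<^sub>v ?v) $ i = (\<Sum>w | w \<in> pverts \<Gamma> \<and> (vs ! i, w) \<in> parcs \<Gamma>. f w)" if "i < ?n" for i
  proof -
    have "(?A *\<^sub>v ?v) $ i = (\<Sum>j = 0..<?n. if (vs ! i, vs ! j) \<in> parcs \<Gamma> then f (vs ! j) else 0)"
      using that by (auto simp: adjacency_matrix_def scalar_prod_def intro!: sum.cong)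
    also have "\<dots> = (\<Sum>w\<in>pverts \<Gamma>. if (vs ! i, w) \<in> parcs \<Gamma> then f w else 0)"
      by (rule sum.reindex_bij_betw[OF bij])
    also have "\<dots> = (\<Sum>w | w \<in> pverts \<Gamma> \<and> (vs ! i, w) \<in> parcs \<Gamma>. f w)"
      by (simp add: sum.inter_filter[OF fin, symmetric])
    finally show ?thesis .
  qed
  then have "?A *\<^sub>v ?v = x \<cdot>\<^sub>v ?v \<longleftrightarrow>
      (\<forall>u\<in>set vs. (\<Sum>w | w \<in> pverts \<Gamma> \<and> (u, w) \<in> parcs \<Gamma>. f w) = x * f u)"
    by (auto simp: vec_eq_iff adjacency_matrix_def all_set_conv_all_nth)
  moreover have "?v \<noteq> 0\<^sub>v ?n \<longleftrightarrow> (\<exists>u\<in>set vs. f u \<noteq> 0)"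
    by (auto simp: vec_eq_iff Bex_def in_set_conv_nth)
  ultimately show ?thesis
    by (auto simp: eigenvector_def adjacency_matrix_def vs)
qed

lemma graph_eigenvalues_iff:
  assumes fin: "finite (pverts \<Gamma>)"
  shows "x \<in> graph_eigenvalues \<Gamma> \<longleftrightarrow> (\<exists>f. (\<exists>u\<in>pverts \<Gamma>. f u \<noteq> 0) \<and>
    (\<forall>u\<in>pverts \<Gamma>. (\<Sum>w | w \<in> pverts \<Gamma> \<and> (u, w) \<in> parcs \<Gamma>. f w) = x * f u))"
    (is "_ \<longleftrightarrow> (\<exists>f. ?E f)")
proof
  assume "x \<in> graph_eigenvalues \<Gamma>"
  then obtain vs v where vs: "distinct vs" "set vs = pverts \<Gamma>"
    and v: "eigenvector (adjacency_matrix \<Gamma> vs) v x"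
    unfolding graph_eigenvalues_def eigenvalue_def by blast
  \<comment> \<open>Inverting the enumeration turns the vector into a function on the
    vertices.\<close>
  define f where "f u = v $ inv_into {..<length vs} ((!) vs) u" for u
  have "inj_on ((!) vs) {..<length vs}"
    using vs(1) by (simp add: inj_on_nth)
  then have "v = vec (length vs) (\<lambda>i. f (vs ! i))"
    using v by (intro eq_vecI) (auto simp: f_def eigenvector_def adjacency_matrix_def)
  then have "eigenvector (adjacency_matrix \<Gamma> vs) (vec (length vs) (\<lambda>i. f (vs ! i))) x"
    using v by (simp only:)
  then have "?E f"
    by (rule iffD1[OF eigenvector_adjacency_matrix[OF vs]])
  then show "\<exists>f. ?E f"
    by (rule exI[of _ f])
next
  assume "\<exists>f. ?E f"
  then obtain f where f: "?E f" ..
  obtain vs where vs: "set vs = pverts \<Gamma>" "distinct vs"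
    using finite_distinct_list[OF fin] by blast
  then show "x \<in> graph_eigenvalues \<Gamma>"
    using iffD2[OF eigenvector_adjacency_matrix[OF vs(2,1)] f]
    unfolding graph_eigenvalues_def eigenvalue_def by blast
qed

text \<open>The substitution \<open>h = s \<otimes> g\<close> identifies the neighbours of
  \<open>g\<close> with the elements of \<open>S\<close>.\<close>

lemma graph_eigenvalues_Cay_iff:
  assumes "group G" and fin: "finite (carrier G)" and S: "S \<subseteq> carrier G"
  shows "x \<in> graph_eigenvalues (Cay G S) \<longleftrightarrow> (\<exists>f. (\<exists>g\<in>carrier G. f g \<noteq> 0) \<and>
    (\<forall>g\<in>carrier G. (\<Sum>s\<in>S. f (s \<otimes>\<^bsub>G\<^esub> g)) = x * f g))"
proof -
  interpret group G by fact
  have "(\<Sum>h | h \<in> carrier G \<and> (g, h) \<in> parcs (Cay G S). f h) = (\<Sum>s\<in>S. f (s \<otimes>\<^bsub>G\<^esub> g))"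
    if g: "g \<in> carrier G" for g and f :: "'a \<Rightarrow> complex"
    by (rule sum.reindex_bij_witness[of _ "\<lambda>s. s \<otimes>\<^bsub>G\<^esub> g" "\<lambda>h. h \<otimes>\<^bsub>G\<^esub> inv\<^bsub>G\<^esub> g"])
      (use g S in \<open>auto simp: Cay_def m_assoc subset_eq\<close>)
  then show ?thesis
    using graph_eigenvalues_iff[of "Cay G S" x] fin by (simp add: Cay_def)
qed

section \<open>Spectra for subgroups and for pairs of inverse elements\<close>

lemma subgroup_minus_one_connection_set:
  assumes "group G" "subgroup H G"
  shows "connection_set G (H - {\<one>\<^bsub>G\<^esub>})"
proof -
  interpret group G by fact
  interpret H: subgroup H G by fact
  have inv: "inv\<^bsub>G\<^esub> s \<in> H - {\<one>\<^bsub>G\<^esub>}" if "s \<in> H - {\<one>\<^bsub>G\<^esub>}" for s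
    using that by auto
  have "s \<in> (\<lambda>s. inv\<^bsub>G\<^esub> s) ` (H - {\<one>\<^bsub>G\<^esub>})" if "s \<in> H - {\<one>\<^bsub>G\<^esub>}" for s
    by (rule image_eqI[of _ _ "inv\<^bsub>G\<^esub> s"]) (use that inv in auto)
  then have "H - {\<one>\<^bsub>G\<^esub>} = (\<lambda>s. inv\<^bsub>G\<^esub> s) ` (H - {\<one>\<^bsub>G\<^esub>})"
    using inv by (intro equalityI subsetI) (assumption | erule imageE, simp only:)+
  then show ?thesis
    using H.subset unfolding connection_set_def by blast
qed

text \<open>The graph is a disjoint union of complete graphs on the cosets of \<open>H\<close>.\<close>

lemma graph_eigenvalues_subgroup:
  assumes "group G" and fin: "finite (carrier G)" and H: "subgroup H G"
    and x: "x \<in> graph_eigenvalues (Cay G (H - {\<one>\<^bsub>G\<^esub>}))"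
  shows "x = -1 \<or> x = of_nat (card H) - 1"
proof -
  interpret group G by fact
  interpret H: subgroup H G by fact
  have finH: "finite H"
    using fin H.subset finite_subset by blast
  obtain f g where g: "g \<in> carrier G" "f g \<noteq> 0"
    and f: "\<And>g. g \<in> carrier G \<Longrightarrow> (\<Sum>s\<in>H - {\<one>\<^bsub>G\<^esub>}. f (s \<otimes>\<^bsub>G\<^esub> g)) = x * f g"
    using x graph_eigenvalues_Cay_iff[OF assms(1) fin, of "H - {\<one>\<^bsub>G\<^esub>}" x] H.subset by blast
  \<comment> \<open>The sum of \<open>f\<close> over the coset of \<open>g\<close>. Adding the
    missing term for the identity to the eigenvalue equation at \<open>h \<otimes> g\<close> gives
    \<open>\<sigma> = (x + 1) * f (h \<otimes> g)\<close> for each \<open>h\<close> in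
    \<open>H\<close>.\<close>
  define \<sigma> where "\<sigma> = (\<Sum>s\<in>H. f (s \<otimes>\<^bsub>G\<^esub> g))"
  have \<sigma>: "\<sigma> = (x + 1) * f (h \<otimes>\<^bsub>G\<^esub> g)" if h: "h \<in> H" for h
  proof -
    have cancel: "inv\<^bsub>G\<^esub> h \<otimes>\<^bsub>G\<^esub> (h \<otimes>\<^bsub>G\<^esub> g) = g"
      using g h by (simp add: m_assoc[symmetric])
    have "\<sigma> = (\<Sum>s\<in>H. f (s \<otimes>\<^bsub>G\<^esub> (h \<otimes>\<^bsub>G\<^esub> g)))"
      unfolding \<sigma>_def
      by (rule sum.reindex_bij_witness[of _ "\<lambda>s. s \<otimes>\<^bsub>G\<^esub> h" "\<lambda>s. s \<otimes>\<^bsub>G\<^esub> inv\<^bsub>G\<^esub> h"])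
        (use g h in \<open>auto simp: m_assoc cancel\<close>)
    also have "\<dots> = f (h \<otimes>\<^bsub>G\<^esub> g) + (\<Sum>s\<in>H - {\<one>\<^bsub>G\<^esub>}. f (s \<otimes>\<^bsub>G\<^esub> (h \<otimes>\<^bsub>G\<^esub> g)))"
      using g h finH by (subst sum.remove[of _ "\<one>\<^bsub>G\<^esub>"]) auto
    also have "\<dots> = (x + 1) * f (h \<otimes>\<^bsub>G\<^esub> g)"
      using f[of "h \<otimes>\<^bsub>G\<^esub> g"] g h by (simp add: algebra_simps)
    finally show ?thesis .
  qed
  \<comment> \<open>Summing the previous identity over \<open>H\<close> produces \<sigma> again on
    the right.\<close>
  have "(x + 1) * \<sigma> = (\<Sum>s\<in>H. \<sigma>)"
    unfolding \<sigma>_def[THEN arg_cong, of "(*) (x + 1)"] sum_distrib_left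
    by (rule sum.cong[OF refl]) (use \<sigma> in simp)
  then have "(x + 1) * \<sigma> = of_nat (card H) * \<sigma>"
    by simp
  moreover have "\<sigma> = (x + 1) * f g"
    using \<sigma>[of "\<one>\<^bsub>G\<^esub>"] g by simp
  ultimately have "(x + 1) * (x + 1 - of_nat (card H)) * f g = 0"
    by (simp add: algebra_simps)
  then have "x + 1 = 0 \<or> x + 1 = of_nat (card H)"
    using g by simp
  then show ?thesis
    by (auto simp: add_eq_0_iff2 eq_diff_eq)
qed

lemma cyclic_graph_eigenvalue:
  fixes \<zeta> :: complex
  assumes "group G" and fin: "finite (carrier G)"
    and h: "h \<in> carrier G" "h \<noteq> inv\<^bsub>G\<^esub> h" and \<zeta>: "\<zeta> ^ group.ord G h = 1"
  shows "\<zeta> + inverse \<zeta> \<in> graph_eigenvalues (Cay G {h, inv\<^bsub>G\<^esub> h})"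
proof -
  interpret group G by fact
  have "ord h > 0"
    using ord_ge_1[OF fin h(1)] by simp
  then have "\<zeta> \<noteq> 0"
    using \<zeta> by (auto simp: power_0_left)
  \<comment> \<open>The character \<open>h\<^sup>i \<mapsto> \<zeta>\<^sup>i\<close> of \<open>\<langle>h\<rangle>\<close>, extended by zero, is an eigenfunction.\<close>
  define f where "f g = (if \<exists>i::int. g = h [^]\<^bsub>G\<^esub> i then \<zeta> powi (SOME i::int. g = h [^]\<^bsub>G\<^esub> i) else 0)" for g
  have f_pow: "f (h [^]\<^bsub>G\<^esub> i) = \<zeta> powi i" for i :: int
  proof -
    \<comment> \<open>The choice of exponent is harmless: two exponents differ by a multiple of
      \<open>ord h\<close>, and \<zeta> to that power is 1.\<close>
    define j where "j = (SOME j::int. h [^]\<^bsub>G\<^esub> i = h [^]\<^bsub>G\<^esub> j)"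
    have "h [^]\<^bsub>G\<^esub> i = h [^]\<^bsub>G\<^esub> j"
      unfolding j_def by (rule someI[of _ i]) simp
    then have "int (ord h) dvd j - i"
      using h(1) by (simp add: int_pow_eq)
    then obtain k where "j = i + int (ord h) * k"
      by (metis dvd_def add.commute diff_add_cancel)
    then have "\<zeta> powi j = \<zeta> powi i"
      using \<zeta> \<open>\<zeta> \<noteq> 0\<close> by (simp add: power_int_add power_int_mult)
    then show ?thesis
      by (auto simp: f_def j_def)
  qed
  have mult: "h [^]\<^bsub>G\<^esub> k \<otimes>\<^bsub>G\<^esub> g = h [^]\<^bsub>G\<^esub> (k + i)" if "g = h [^]\<^bsub>G\<^esub> i" for g and i k :: int
    using that h(1) by (simp add: int_pow_mult)
  have f_mult: "f (h [^]\<^bsub>G\<^esub> k \<otimes>\<^bsub>G\<^esub> g) = \<zeta> powi k * f g" if g: "g \<in> carrier G" for g and k :: int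
  proof (cases "\<exists>i::int. g = h [^]\<^bsub>G\<^esub> i")
    case True
    then obtain i :: int where "g = h [^]\<^bsub>G\<^esub> i" ..
    then show ?thesis
      using mult[of g i k] \<open>\<zeta> \<noteq> 0\<close> by (simp add: f_pow power_int_add)
  next
    case False
    \<comment> \<open>If the product were a power of \<open>h\<close>, so would \<open>g\<close> be;
      hence both values of \<open>f\<close> are zero here.\<close>
    have "g = h [^]\<^bsub>G\<^esub> (- k + i)" if "h [^]\<^bsub>G\<^esub> k \<otimes>\<^bsub>G\<^esub> g = h [^]\<^bsub>G\<^esub> i" for i :: int
      using mult[OF that, of "- k"] g h(1) by (simp add: int_pow_neg m_assoc[symmetric])
    then show ?thesis
      using False by (auto simp: f_def)
  qed
  \<comment> \<open>As \<open>h\<close> differs from its inverse, the sum has exactly two terms,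
    with exponents 1 and -1.\<close>
  have "(\<Sum>s\<in>{h, inv\<^bsub>G\<^esub> h}. f (s \<otimes>\<^bsub>G\<^esub> g)) = (\<zeta> + inverse \<zeta>) * f g" if "g \<in> carrier G" for g
    using f_mult[OF that, of 1] f_mult[OF that, of "-1"] h
    by (simp add: int_pow_neg power_int_minus algebra_simps)
  moreover have "f \<one>\<^bsub>G\<^esub> \<noteq> 0"
    using f_pow[of 0] by simp
  ultimately show ?thesis
    using graph_eigenvalues_Cay_iff[OF assms(1) fin, of "{h, inv\<^bsub>G\<^esub> h}"] h(1) by blast
qed

lemma cyclic_not_two_integral:
  assumes "group G" and fin: "finite (carrier G)" and h: "h \<in> carrier G"
    and p: "prime (group.ord G h)" "group.ord G h \<ge> 7"
  shows "h \<noteq> inv\<^bsub>G\<^esub> h" and "\<not> two_integral (Cay G {h, inv\<^bsub>G\<^esub> h})"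
proof -
  interpret group G by fact
  let ?p = "ord h" and ?\<zeta> = "cis (2 * pi / ord h)"
  show ne: "h \<noteq> inv\<^bsub>G\<^esub> h"
  proof
    assume "h = inv\<^bsub>G\<^esub> h"
    then have "h [^]\<^bsub>G\<^esub> (2::nat) = \<one>\<^bsub>G\<^esub>"
      using h by (metis r_inv numeral_2_eq_2 nat_pow_Suc nat_pow_0 l_one)
    then have "ord h dvd 2"
      using h by (simp add: pow_eq_id)
    then show False
      using p(2) by (auto dest: dvd_imp_le)
  qed
  have \<zeta>: "?\<zeta> ^ ?p = 1"
    using p(2) by (simp add: DeMoivre)
  have "?\<zeta> \<noteq> 1"
  proof
    assume "?\<zeta> = 1"
    then have "cos (2 * pi / ?p) = 1"
      by (metis cis.sel(1) one_complex.sel(1))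
    then obtain n :: int where "2 * pi / ?p = of_int n * 2 * pi"
      unfolding cos_one_2pi_int by blast
    then have "of_int (n * int ?p) = (1 :: real)"
      using p(2) by (simp add: field_simps)
    then have "n * int ?p = 1"
      by linarith
    then show False
      using p(2) by (auto simp: zmult_eq_1_iff)
  qed
  show "\<not> two_integral (Cay G {h, inv\<^bsub>G\<^esub> h})"
  proof
    assume "two_integral (Cay G {h, inv\<^bsub>G\<^esub> h})"
    then obtain a b c where "a \<in> \<rat>" "b \<in> \<rat>" "c \<in> \<rat>" "\<not> (a = 0 \<and> b = 0 \<and> c = 0)"
      "a + b * (?\<zeta> + inverse ?\<zeta>) + c * (?\<zeta> + inverse ?\<zeta>)\<^sup>2 = 0"
      using eigenvalue_quadratic[OF _ cyclic_graph_eigenvalue[OF assms(1) fin h ne \<zeta>]] by metis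
    then show False
      using no_rational_quadratic[OF p \<zeta> \<open>?\<zeta> \<noteq> 1\<close>] by blast
  qed
qed

section \<open>Case distinction on the group order\<close>

text \<open>If 4 does not divide \<open>n\<close>, then \<open>n\<close> or its half is odd and
  greater than 1, and so has an odd prime factor. The form \<open>q ^ a\<close> is the one that
  Sylow's theorem takes.\<close>

lemma ge_3_divisor_cases:
  fixes n :: nat
  assumes "n \<ge> 3"
  obtains q a where "prime q" "q ^ a dvd n" "q ^ a \<in> {3, 4, 5}" | p where "prime p" "p \<ge> 7" "p dvd n"
proof (cases "4 dvd n")
  case True
  then show ?thesis
    using that(1)[of 2 2] by simp
next
  case False
  obtain m where m: "m > 1" "odd m" "m dvd n"
  proof (cases "even n")
    case True
    then obtain m where "n = 2 * m" ..
    with False assms show ?thesis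
      by (intro that[of m]) (auto elim: evenE)
  qed (use assms that[of n] in auto)
  obtain p where p: "prime p" "p dvd m"
    using m(1) prime_factor_nat[of m] by auto
  then have "odd p" "p \<ge> 2"
    using m(2) prime_ge_2_nat by (auto dest: dvd_trans)
  then have "p = 3 \<or> p = 5 \<or> p \<ge> 7"
    by presburger
  then show ?thesis
    using that(1)[of p 1] that(2)[of p] p m(3) dvd_trans by auto
qed

text \<open>Groups of order at most 2 belong to \<open>\<B> k\<close> vacuously, by
  \<open>order_le_2_in_\<B>\<close>; emptiness is therefore asserted of the remaining
  groups.\<close>

theorem theorem6p3:
  fixes k :: nat
  assumes "k \<ge> 4"
  shows "(\<B> k :: 'a monoid set) - {G. Coset.order G \<le> 2} = {}"
proof -
  have False if G: "G \<in> \<B> k" and le: "\<not> Coset.order G \<le> 2" for G :: "'a monoid"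
  proof -
    have "group G" and fin: "finite (carrier G)"
      \<comment> \<open>The sets used below have 2, 3 or 4 elements; 4 occurs for a subgroup of
        order 5.\<close>
      and two: "\<And>S. connection_set G S \<Longrightarrow> 2 \<le> card S \<Longrightarrow> card S \<le> 4 \<Longrightarrow> two_integral (Cay G S)"
      using G assms by (auto simp: \<B>_def)
    interpret group G by fact
    have "Coset.order G \<ge> 3"
      using le by simp
    then show False
    proof (cases rule: ge_3_divisor_cases)
      case (1 q a)
      \<comment> \<open>\<open>sylow_thm\<close> covers every prime power dividing the order, so
        order 4 is available even when 8 divides it.\<close>
      then obtain H where H: "subgroup H G" "card H \<in> {3, 4, 5}"
        using sylow_thm[OF _ \<open>group G\<close> _ fin] by (metis dvdE)
      interpret H: subgroup H G by fact
      have "card (H - {\<one>\<^bsub>G\<^esub>}) = card H - 1"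
        by (simp add: card_Diff_singleton)
      then have "two_integral (Cay G (H - {\<one>\<^bsub>G\<^esub>}))"
        using H by (intro two subgroup_minus_one_connection_set \<open>group G\<close>) auto
      moreover have "graph_eigenvalues (Cay G (H - {\<one>\<^bsub>G\<^esub>})) \<subseteq> \<rat>"
        using graph_eigenvalues_subgroup[OF \<open>group G\<close> fin H(1)] by fastforce
      ultimately show False
        using rational_eigenvalues_not_two_integral by blast
    next
      case (2 p)
      then obtain H where H: "subgroup H G" "card H = p"
        using sylow_thm[OF _ \<open>group G\<close> _ fin, of p 1] by (metis dvdE power_one_right)
      interpret H: subgroup H G by fact
      have "H \<noteq> {\<one>\<^bsub>G\<^esub>}"
        using H(2) 2 by auto
      then obtain h where h: "h \<in> H" "h \<noteq> \<one>\<^bsub>G\<^esub>"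
        using H.one_closed by blast
      then have hG: "h \<in> carrier G"
        by auto
      \<comment> \<open>Lagrange's theorem inside \<open>H\<close>; as \<open>p\<close> is prime,
        the nontrivial \<open>h\<close> then has order exactly \<open>p\<close>.\<close>
      have "h [^]\<^bsub>G\<^esub> p = \<one>\<^bsub>G\<^esub>"
        using group.pow_order_eq_1[OF H.subgroup_is_group[OF \<open>group G\<close>], of h] h(1) H(2)
        by (simp add: Coset.order_def nat_pow_consistent[symmetric])
      then have "ord h dvd p"
        using hG by (simp add: pow_eq_id)
      moreover have "ord h \<noteq> 1"
        using ord_eq_1[OF hG] h by simp
      ultimately have ord: "ord h = p"
        using \<open>prime p\<close> by (auto simp: prime_nat_iff)
      have "\<one>\<^bsub>G\<^esub> \<noteq> inv\<^bsub>G\<^esub> h"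
        using inv_eq_1_iff[OF hG] h(2) by metis
      then have "connection_set G {h, inv\<^bsub>G\<^esub> h}"
        using hG h(2) by (auto simp: connection_set_def)
      moreover have "card {h, inv\<^bsub>G\<^esub> h} = 2"
        using cyclic_not_two_integral(1)[OF \<open>group G\<close> fin hG] ord 2 by simp
      ultimately have "two_integral (Cay G {h, inv\<^bsub>G\<^esub> h})"
        by (intro two) auto
      then show False
        using cyclic_not_two_integral(2)[OF \<open>group G\<close> fin hG] ord 2 by blast
    qed
  qed
  then show ?thesis
    by blast
qed

end
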